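(* Let $n>1$ be an integer, let $p\in\{1,\ldots,n\}$, and let $k\in\mathbb{R}$ with $k\geq 0$ and $k\geq p-1$. Then for all positive real numbers $x_1,\ldots,x_n$, $$\sum_{i=1}^{n}\left(\frac{x_i}{x_{i+1}}\right)^k\geq \sum_{i=1}^{n}\frac{x_i}{x_{i+p-1}}.$$
   Context: Indices of the variables are understood cyclically modulo $n$, i.e. $x_{j+n}=x_j$ for every integer $j$. *)

theory Defs
  imports Complex_Main
begin

end

theory Submission
  imports Defs
begin

text \<open>
  Put \<open>l j = ln (x j / x (j + 1))\<close> and \<open>q = p - 1\<close>, so that \<open>x i / x (i + q)\<close> is the
  exponential of \<open>l i + \<dots> + l (i + q - 1)\<close>, a convex combination of \<open>k * l j\<close> (weight \<open>1 / k\<close> each)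
  and \<open>0\<close> (weight \<open>1 - q / k\<close>). By convexity and summation over the cycle, the right-hand side is at
  most \<open>(q / k) * S + (1 - q / k) * n\<close>, where \<open>S\<close> is the left-hand side; and \<open>S \<ge> n\<close> because the
  \<open>l j\<close> sum to \<open>0\<close>.
\<close>

text \<open>The tangent to \<open>exp\<close> at \<open>A\<close>, the sum of the
  \<open>l j\<close>, lies below the graph. It is evaluated at each \<open>k * l j\<close> with
  weight 1 and at 0 with weight \<open>k - real q\<close>. The total weight is \<open>k\<close> and
  the weighted points add up to \<open>k * A\<close>, so the linear terms cancel. Weights are not
  normalised by \<open>1 / k\<close>, so \<open>k = 0\<close> is allowed.\<close>

lemma exp_sum_le:
  fixes l :: "nat \<Rightarrow> real" and k :: real
  assumes "real q \<le> k"
  shows "k * exp (\<Sum>j<q. l j) \<le> (\<Sum>j<q. exp (k * l j)) + (k - real q)"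
proof -
  define A where "A = (\<Sum>j<q. l j)"
  have tangent: "exp A * (1 + (t - A)) \<le> exp t" for t :: real
  proof -
    have "exp A * (1 + (t - A)) \<le> exp A * exp (t - A)"
      by (intro mult_left_mono exp_ge_add_one_self) simp
    then show ?thesis
      by (simp flip: exp_add)
  qed
  have "(k - real q) * (exp A * (1 + (0 - A))) \<le> (k - real q) * exp 0"
    using assms by (intro mult_left_mono tangent) simp
  moreover have "(\<Sum>j<q. exp A * (1 + (k * l j - A))) \<le> (\<Sum>j<q. exp (k * l j))"
    by (intro sum_mono tangent)
  moreover have "(\<Sum>j<q. exp A * (1 + (k * l j - A))) = exp A * (real q + k * A - real q * A)"
    by (simp add: A_def sum.distrib sum_subtractf flip: sum_distrib_left)
  ultimately show ?thesis
    by (simp add: A_def[symmetric] algebra_simps)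
qed

lemma periodic_mult:
  fixes f :: "int \<Rightarrow> 'a"
  assumes "\<And>j. f (j + c) = f j"
  shows "f (j + m * c) = f j"
proof (induction m rule: int_induct[where k = 0])
  case (step1 m)
  then show ?case
    using assms[of "j + m * c"] by (simp add: algebra_simps)
next
  case (step2 m)
  then show ?case
    using assms[of "j + (m - 1) * c"] by (simp add: algebra_simps)
qed simp

lemma sum_periodic_shift:
  fixes f :: "int \<Rightarrow> 'a::comm_monoid_add"
  assumes periodic: "\<And>j. f (j + int n) = f j"
  shows "(\<Sum>i=1..int n. f (i + int m)) = (\<Sum>i=1..int n. f i)"
proof (cases "n = 0")
  case False
  show ?thesis
  proof (induction m)
    case (Suc m)
    let ?g = "\<lambda>i. f (i + int m)"
    have "(\<Sum>i=1..int n. ?g (i + 1)) = sum ?g {2..int n + 1}"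
      by (rule sum.reindex_bij_witness[of _ "\<lambda>i. i - 1" "\<lambda>i. i + 1"]) auto
    also have "{2..int n + 1} = insert (int n + 1) {2..int n}"
      using False by auto
    also have "sum ?g \<dots> = ?g (int n + 1) + sum ?g {2..int n}"
      by simp
    also have "?g (int n + 1) = ?g 1"
      using periodic[of "1 + int m"] by (simp add: algebra_simps)
    also have "?g 1 + sum ?g {2..int n} = sum ?g (insert 1 {2..int n})"
      by simp
    also have "insert 1 {2..int n} = {1..int n}"
      using False by auto
    finally show ?case
      using Suc by (simp add: algebra_simps)
  qed simp
qed simp

theorem corollary2p3:
  fixes n p :: nat and k :: real and x :: "int \<Rightarrow> real"
  assumes "n > 1"
    and "p \<in> {1..n}"
    and "k \<ge> 0" and "k \<ge> real p - 1"
    and "\<And>j. x (j + int n) = x j"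
    and "\<And>i. i \<in> {1..int n} \<Longrightarrow> x i > 0"
  shows "(\<Sum>i=1..int n. (x i / x (i + 1)) powr k) \<ge> (\<Sum>i=1..int n. x i / x (i + int p - 1))"
proof -
  define q where "q = p - 1"
  have p: "int p = int q + 1" and qk: "real q \<le> k"
    using assms(2,4) by (auto simp: q_def of_nat_diff)
  \<comment> \<open>Positivity is given on one period only. Since \<open>mod\<close> yields residues
    from 0 to \<open>n - 1\<close>, the index is lowered by 1 before reduction and raised again
    afterwards.\<close>
  have pos: "x i > 0" for i
  proof -
    have "0 \<le> (i - 1) mod int n" "(i - 1) mod int n < int n"
      using \<open>n > 1\<close> by auto
    then have "x ((i - 1) mod int n + 1) > 0"
      by (intro assms(6)) auto
    moreover have "i = (i - 1) mod int n + 1 + (i - 1) div int n * int n"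
      using div_mult_mod_eq[of "i - 1" "int n"] by linarith
    ultimately show ?thesis
      using periodic_mult[of x "int n" "(i - 1) mod int n + 1" "(i - 1) div int n"] assms(5) by simp
  qed
  define l where "l = (\<lambda>j. ln (x j) - ln (x (j + 1)))"
  define S where "S = (\<Sum>i=1..int n. exp (k * l i))"
  define R where "R = (\<Sum>i=1..int n. x i / x (i + int q))"
  have l_per: "l (j + int n) = l j" for j
    using assms(5)[of j] assms(5)[of "j + 1"] by (simp add: l_def algebra_simps)
  have S: "(\<Sum>i=1..int n. (x i / x (i + 1)) powr k) = S"
    unfolding S_def l_def using pos
    by (intro sum.cong refl) (simp add: powr_def ln_div less_imp_neq[symmetric])
  have "(\<Sum>i=1..int n. l i) = 0"
    using sum_periodic_shift[of "\<lambda>j. ln (x j)" n 1] assms(5) by (simp add: l_def sum_subtractf)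
  \<comment> \<open>This is the tangent to \<open>exp\<close> at 0; its linear part vanishes on
    summing over the cycle.\<close>
  moreover have "(\<Sum>i=1..int n. 1 + k * l i) \<le> S"
    unfolding S_def by (intro sum_mono exp_ge_add_one_self)
  ultimately have n_le: "real n \<le> S"
    by (simp add: sum.distrib flip: sum_distrib_left)
  have telescope: "x i / x (i + int q) = exp (\<Sum>j<q. l (i + int j))" for i
  proof -
    have "(\<Sum>j<q. l (i + int j)) = ln (x i) - ln (x (i + int q))"
      using sum_lessThan_telescope'[of "\<lambda>j. ln (x (i + int j))" q] by (simp add: l_def ac_simps)
    then show ?thesis
      using pos by (simp add: exp_diff)
  qed
  have "k * R \<le> (\<Sum>i=1..int n. (\<Sum>j<q. exp (k * l (i + int j))) + (k - real q))"
    unfolding R_def telescope sum_distrib_left by (intro sum_mono exp_sum_le qk)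
  \<comment> \<open>After the swap, each inner sum is a cyclic shift of \<open>S\<close>.\<close>
  also have "\<dots> = (\<Sum>j<q. \<Sum>i=1..int n. exp (k * l (i + int j))) + real n * (k - real q)"
    by (simp add: sum.distrib sum.swap[of _ "{..<q}"])
  also have "\<dots> = real q * S + real n * (k - real q)"
    using sum_periodic_shift[of "\<lambda>j. exp (k * l j)"] l_per by (simp add: S_def)
  also have "\<dots> \<le> real q * S + S * (k - real q)"
    using n_le qk by (intro add_left_mono mult_right_mono) auto
  finally have kR: "k * R \<le> k * S"
    by (simp add: algebra_simps)
  have "R \<le> S"
  \<comment> \<open>The factor \<open>k\<close> in \<open>kR\<close> cannot be cancelled when it is
    0; but then \<open>q = 0\<close> and every term of \<open>R\<close> is 1.\<close>
  proof (cases "k = 0")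
    case True
    then have "R = real n"
      using qk pos by (simp add: R_def less_imp_neq[symmetric])
    then show ?thesis
      using n_le by simp
  next
    case False
    then show ?thesis
      using kR \<open>k \<ge> 0\<close> by simp
  qed
  then show ?thesis
    using S by (simp add: R_def p)
qed

end
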